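(* Let $(G,\upsilon,\varepsilon)$ be a weighted multigraph on $n$ vertices and write $$P_{(G,\upsilon,\varepsilon)}(t)=\sum_{k=1}^{n}(-1)^{n-k}c_kt^k .$$ Then for each $1\le k\le n$, $$c_k=\sum_F w(F),$$ where the sum is over all $k$-component spanning forests $F$ of $G$.
   Context: A graph is a finite multigraph with vertex set $V$ and edge set $E$ (loops and multiple edges allowed). A weighted multigraph $(G,\upsilon,\varepsilon)$ is a graph $G$ with vertex weights $\upsilon:V\to\mathbb R_{>0}$ and edge weights $\varepsilon:E\to\mathbb R_{>0}$. For $u,v\in V$, $\varepsilon(u,v)$ is the total edge weight between $u$ and $v$, with loops counted twice, and $d_{(G,\varepsilon)}(u)=\sum_{v\in V}\varepsilon(u,v)$. The combinatorial Laplacian is the $V\times V$ matrix $L_{(G,\varepsilon)}=D_{(G,\varepsilon)}-A_{(G,\varepsilon)}$, where $A_{(G,\varepsilon)}=(\varepsilon(u,v))_{u,v}$ and $D_{(G,\varepsilon)}$ is diagonal with entries $d_{(G,\varepsilon)}(v)$. Let $W_\upsilon$ be the diagonal matrix with entries $\upsilon(v)$, and define $$P_{(G,\upsilon,\varepsilon)}(t)=\det(tW_\upsilon-L_{(G,\varepsilon)}).$$ A spanning forest $F$ of $G$ is an acyclic subgraph containing all vertices of $G$ (determined by its edge set). Its weight is $$w(F)=\prod_{T\in F}\left[\left(\sum_{v\in V(T)}\upsilon(v)\right)\prod_{e\in E(T)}\varepsilon(e)\right],$$ where the outer product is over all connected components $T$ of $F$. *)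

theory Defs
  imports "HOL-Analysis.Analysis" "HOL-Computational_Algebra.Polynomial"
begin

text \<open>
  The vertex set is the finite type \<open>'v\<close>. The edges form a set of labels, so that
  parallel edges are distinct elements; \<open>ends g e\<close> is the set of end-points of \<open>e\<close>,
  which is a singleton iff \<open>e\<close> is a loop. The values of \<open>ends\<close> and \<open>ewt\<close> outside
  \<open>edges g\<close> are irrelevant.
\<close>

record ('v, 'e) weighted_multigraph =
  edges :: "'e set"
  ends :: "'e \<Rightarrow> 'v set"
  vwt :: "'v \<Rightarrow> real"
  ewt :: "'e \<Rightarrow> real"

definition wf_weighted_multigraph :: "('v::finite, 'e) weighted_multigraph \<Rightarrow> bool" where
  "wf_weighted_multigraph g \<longleftrightarrow>
     finite (edges g) \<and>
     (\<forall>e\<in>edges g. \<exists>u v. ends g e = {u, v}) \<and>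
     (\<forall>v. vwt g v > 0) \<and>
     (\<forall>e\<in>edges g. ewt g e > 0)"

definition total_ewt :: "('v::finite, 'e) weighted_multigraph \<Rightarrow> 'v \<Rightarrow> 'v \<Rightarrow> real" where
  "total_ewt g u v =
     (\<Sum>e\<in>{e \<in> edges g. ends g e = {u, v}}. if u = v then 2 * ewt g e else ewt g e)"

definition wdegree :: "('v::finite, 'e) weighted_multigraph \<Rightarrow> 'v \<Rightarrow> real" where
  "wdegree g u = (\<Sum>v\<in>UNIV. total_ewt g u v)"

definition adjacency_matrix :: "('v::finite, 'e) weighted_multigraph \<Rightarrow> real^'v^'v" where
  "adjacency_matrix g = (\<chi> u v. total_ewt g u v)"

definition degree_matrix :: "('v::finite, 'e) weighted_multigraph \<Rightarrow> real^'v^'v" where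
  "degree_matrix g = (\<chi> u v. if u = v then wdegree g u else 0)"

definition laplacian :: "('v::finite, 'e) weighted_multigraph \<Rightarrow> real^'v^'v" where
  "laplacian g = degree_matrix g - adjacency_matrix g"

definition vwt_matrix :: "('v::finite, 'e) weighted_multigraph \<Rightarrow> real^'v^'v" where
  "vwt_matrix g = (\<chi> u v. if u = v then vwt g u else 0)"

text \<open>The determinant is taken over \<open>real poly\<close>, with \<open>[:0, 1:]\<close> as the indeterminate \<open>t\<close>.\<close>

definition laplacian_poly :: "('v::finite, 'e) weighted_multigraph \<Rightarrow> real poly" where
  "laplacian_poly g =
     det (\<chi> u v. [:0, 1:] * [:vwt_matrix g $ u $ v:] - [:laplacian g $ u $ v:])"

lemma poly_laplacian_poly:
  "poly (laplacian_poly g) t = det (t *\<^sub>R vwt_matrix g - laplacian g)"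
  by (simp add: laplacian_poly_def det_def poly_sum poly_prod)

text \<open>
  A cycle in the edge set \<open>F\<close> has vertices \<open>vs\<close> and edges \<open>es\<close>, the \<open>i\<close>-th edge joining
  the \<open>i\<close>-th vertex to the cyclically next one. Loops are cycles of length 1 and pairs
  of parallel edges are cycles of length 2.
\<close>

definition is_cycle ::
  "('v::finite, 'e) weighted_multigraph \<Rightarrow> 'e set \<Rightarrow> 'v list \<Rightarrow> 'e list \<Rightarrow> bool" where
  "is_cycle g F vs es \<longleftrightarrow>
     es \<noteq> [] \<and> length vs = length es \<and> distinct vs \<and> distinct es \<and> set es \<subseteq> F \<and>
     (\<forall>i<length es. ends g (es ! i) = {vs ! i, vs ! (Suc i mod length es)})"

definition is_spanning_forest :: "('v::finite, 'e) weighted_multigraph \<Rightarrow> 'e set \<Rightarrow> bool" where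
  "is_spanning_forest g F \<longleftrightarrow> F \<subseteq> edges g \<and> (\<nexists>vs es. is_cycle g F vs es)"

definition connected_rel :: "('v::finite, 'e) weighted_multigraph \<Rightarrow> 'e set \<Rightarrow> ('v \<times> 'v) set" where
  "connected_rel g F = {(u, v). \<exists>e\<in>F. ends g e = {u, v}}\<^sup>*"

text \<open>
  A connected component of the spanning subgraph with edge set \<open>F\<close> is represented by its
  vertex set (isolated vertices give singletons).
\<close>

definition components_of :: "('v::finite, 'e) weighted_multigraph \<Rightarrow> 'e set \<Rightarrow> 'v set set" where
  "components_of g F = UNIV // connected_rel g F"

definition component_edges ::
  "('v::finite, 'e) weighted_multigraph \<Rightarrow> 'e set \<Rightarrow> 'v set \<Rightarrow> 'e set" where
  "component_edges g F T = {e \<in> F. ends g e \<subseteq> T}"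

definition forest_weight :: "('v::finite, 'e) weighted_multigraph \<Rightarrow> 'e set \<Rightarrow> real" where
  "forest_weight g F =
     (\<Prod>T\<in>components_of g F. (\<Sum>v\<in>T. vwt g v) * (\<Prod>e\<in>component_edges g F T. ewt g e))"

definition spanning_forests ::
  "('v::finite, 'e) weighted_multigraph \<Rightarrow> nat \<Rightarrow> 'e set set" where
  "spanning_forests g k = {F. is_spanning_forest g F \<and> card (components_of g F) = k}"

end

theory Submission
  imports Defs
begin

text \<open>
  Choose an orientation \<open>s e \<rightarrow> t e\<close> of every edge and let \<open>b\<^sub>e\<close> be the difference of
  the unit vectors at its two ends, so that the Laplacian is the sum of the rank-one matrices
  \<open>\<epsilon>(e) b\<^sub>e b\<^sub>e\<^sup>T\<close> and loops contribute \<open>0\<close>. Over any commutative ring,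
  \<open>det (diag x + \<Sum>\<^sub>e w\<^sub>e b\<^sub>e b\<^sub>e\<^sup>T) = \<Sum>\<^sub>F (\<Prod>\<^sub>e\<^sub>\<in>\<^sub>F w\<^sub>e) \<cdot> (\<Prod>\<^sub>T \<Sum>\<^sub>v\<^sub>\<in>\<^sub>T x\<^sub>v)\<close>,
  where \<open>F\<close> ranges over the spanning forests and \<open>T\<close> over the components of \<open>F\<close>.
  In \<open>real poly\<close> with indeterminate \<open>X\<close>, for \<open>x\<^sub>v = \<upsilon>(v) X\<close> and \<open>w\<^sub>e = - \<epsilon>(e)\<close>, the
  left-hand side is the polynomial \<open>P\<close>, and a forest with \<open>k\<close> components has \<open>n - k\<close> edges, so it contributes
  \<open>(-1)\<^sup>n\<^sup>-\<^sup>k w(F) X\<^sup>k\<close>.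

  The identity is proved by deletion and contraction. Adding an edge \<open>e\<close> between \<open>a\<close> and
  \<open>b\<close> is a rank-one update of the matrix. Adding row \<open>b\<close> to row \<open>a\<close> and column \<open>b\<close> to
  column \<open>a\<close> keeps the determinant and turns \<open>b\<^sub>e\<close> into minus the unit vector at \<open>b\<close>;
  the determinant then splits into the one without \<open>e\<close> and \<open>w\<^sub>e\<close> times the minor without
  row and column \<open>b\<close>, which is the matrix of the graph in which \<open>e\<close> is contracted
  (\<open>det_contracted_laplacian_insert\<close>).

  A contraction is recorded by a map \<open>\<pi>\<close> that sends every vertex to the representative of the
  block into which it has been merged, so the vertex type never changes. On the combinatorial
  side the forests of the contracted graph are the edge sets \<open>F\<close> each of whose edges lowers the
  number of blocks by one. This counting condition makes the deletion-contraction recursion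
  immediate (\<open>relative_forests_insert\<close>), and for the trivial partition it is equivalent to
  the absence of cycles (\<open>acyclic_iff_card_components\<close>).
\<close>

section \<open>Partitions of the vertex set\<close>

definition kernel_rel :: "('v \<Rightarrow> 'v) \<Rightarrow> ('v \<times> 'v) set" where
  "kernel_rel \<pi> = {(u, v). \<pi> u = \<pi> v}"

definition link :: "('e \<Rightarrow> 'v) \<Rightarrow> ('e \<Rightarrow> 'v) \<Rightarrow> 'e set \<Rightarrow> ('v \<times> 'v) set" where
  "link s t F = {(u, v). \<exists>e\<in>F. {s e, t e} = {u, v}}"

text \<open>
  For an equivalence relation \<open>r\<close> this is the partition generated by \<open>r\<close> and the edges of
  \<open>F\<close>: the components of \<open>F\<close> once the blocks of \<open>r\<close> have been contracted.
\<close>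

definition join_rel :: "('v \<times> 'v) set \<Rightarrow> ('e \<Rightarrow> 'v) \<Rightarrow> ('e \<Rightarrow> 'v) \<Rightarrow> 'e set \<Rightarrow> ('v \<times> 'v) set" where
  "join_rel r s t F = (r \<union> link s t F)\<^sup>*"

text \<open>If \<open>\<pi>\<close> selects representatives, this merges the block of \<open>b\<close> into that of \<open>a\<close>.\<close>

definition redirect :: "('v \<Rightarrow> 'v) \<Rightarrow> 'v \<Rightarrow> 'v \<Rightarrow> 'v \<Rightarrow> 'v" where
  "redirect \<pi> a b = (\<lambda>u. if \<pi> u = b then a else \<pi> u)"

lemma equiv_kernel_rel: "equiv UNIV (kernel_rel \<pi>)"
  by (auto simp: kernel_rel_def equiv_def refl_on_def sym_def trans_def)

lemma sym_kernel_rel: "sym (kernel_rel \<pi>)"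
  by (auto simp: kernel_rel_def sym_def)

lemma kernel_rel_id: "kernel_rel id = Id"
  by (auto simp: kernel_rel_def)

lemma quotient_kernel_rel: "UNIV // kernel_rel \<pi> = (\<lambda>i. \<pi> -` {i}) ` range \<pi>"
  by (auto simp: quotient_def kernel_rel_def vimage_def eq_commute)

lemma inj_on_fibre: "inj_on (\<lambda>i. \<pi> -` {i}) (range \<pi>)"
  by (rule inj_onI) blast

lemma card_quotient_kernel_rel: "card (UNIV // kernel_rel \<pi>) = card (range \<pi>)"
  by (simp add: quotient_kernel_rel card_image inj_on_fibre)

lemma equiv_Id: "equiv UNIV Id"
  using equiv_kernel_rel[of id] by (simp add: kernel_rel_id)

lemma card_quotient_Id: "card (UNIV // (Id :: ('v \<times> 'v) set)) = CARD('v)"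
  using card_quotient_kernel_rel[of "id :: 'v \<Rightarrow> 'v"] by (simp add: kernel_rel_id)

text \<open>
  Passing to a representative map turns questions about numbers of blocks into questions about
  the size of a range.
\<close>

lemma equiv_eq_kernel_rel:
  assumes "equiv UNIV r"
  obtains \<pi> where "r = kernel_rel \<pi>"
proof -
  define \<pi> where "\<pi> = (\<lambda>u. SOME v. v \<in> r `` {u})"
  have "(u, \<pi> u) \<in> r" for u
  proof -
    have "u \<in> r `` {u}" using equiv_class_self[OF assms] by simp
    then have "\<pi> u \<in> r `` {u}" unfolding \<pi>_def by (rule someI)
    then show ?thesis by simp
  qed
  note * = this
  have "r = kernel_rel \<pi>"
  proof (intro equalityI subrelI)
    fix u v assume "(u, v) \<in> r"
    then have "r `` {u} = r `` {v}" using assms by (meson equiv_class_eq)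
    then show "(u, v) \<in> kernel_rel \<pi>" by (simp only: kernel_rel_def \<pi>_def mem_Collect_eq case_prod_conv)
  next
    fix u v assume "(u, v) \<in> kernel_rel \<pi>"
    then have "\<pi> u = \<pi> v" by (simp add: kernel_rel_def)
    then have "(u, \<pi> v) \<in> r" "(\<pi> v, v) \<in> r" using *[of u] *[of v] assms by (auto dest: equivE symD elim: equivE)
    then show "(u, v) \<in> r" using assms by (blast elim: equivE dest: transD)
  qed
  then show thesis by (rule that)
qed

lemma equiv_join_rel:
  assumes "sym r"
  shows "equiv UNIV (join_rel r s t F)"
proof -
  have "sym (r \<union> link s t F)"
    using assms by (auto simp: sym_def link_def insert_commute)
  then show ?thesis
    by (simp add: join_rel_def equiv_def refl_rtrancl sym_rtrancl trans_rtrancl)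
qed

lemma join_rel_empty:
  assumes "equiv UNIV r"
  shows "join_rel r s t {} = r"
proof -
  have "r\<^sup>* = r"
    proof (intro equalityI subrelI)
    fix u v assume "(u, v) \<in> r\<^sup>*"
    then show "(u, v) \<in> r"
    proof induction
      case base
      then show ?case using equiv_class_self[OF assms, of u] by simp
    next
      case (step y z)
      then show ?case using assms by (meson equivE transD)
    qed
  qed auto
  then show ?thesis by (simp add: join_rel_def link_def)
qed

lemma rtrancl_absorb: "(R\<^sup>* \<union> S)\<^sup>* = (R \<union> S)\<^sup>*"
proof (rule rtrancl_subset)
  have "R\<^sup>* \<subseteq> (R \<union> S)\<^sup>*" by (rule rtrancl_mono) simp
  then show "R\<^sup>* \<union> S \<subseteq> (R \<union> S)\<^sup>*" by auto
qed auto

lemma join_rel_insert: "join_rel r s t (insert e F) = join_rel (join_rel r s t {e}) s t F"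
proof -
  have "link s t (insert e F) = link s t {e} \<union> link s t F"
    by (auto simp: link_def)
  then show ?thesis unfolding join_rel_def
    by (simp add: rtrancl_absorb Un_assoc)
qed

lemma join_rel_insert':
  "join_rel r s t (insert e F) = join_rel (join_rel r s t F) s t {e}"
proof -
  have "link s t (insert e F) = link s t F \<union> link s t {e}"
    by (auto simp: link_def)
  then show ?thesis unfolding join_rel_def
    by (simp add: rtrancl_absorb Un_assoc)
qed

lemma join_rel_kernel_rel:
  "join_rel (kernel_rel \<pi>) s t {e} = kernel_rel (redirect \<pi> (\<pi> (s e)) (\<pi> (t e)))" (is "?J = ?K")
proof
  have "kernel_rel \<pi> \<union> link s t {e} \<subseteq> ?K"
    by (auto simp: kernel_rel_def link_def redirect_def doubleton_eq_iff)
  then have "?J \<subseteq> ?K\<^sup>*" unfolding join_rel_def by (rule rtrancl_mono)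
  also have "?K\<^sup>* = ?K" using join_rel_empty[OF equiv_kernel_rel] by (simp add: join_rel_def link_def)
  finally show "?J \<subseteq> ?K" .
  have trans: "(u, v) \<in> ?J \<Longrightarrow> (v, z) \<in> ?J \<Longrightarrow> (u, z) \<in> ?J" for u v z
    unfolding join_rel_def by (rule rtrancl_trans)
  have st: "(s e, t e) \<in> ?J" "(t e, s e) \<in> ?J" unfolding join_rel_def link_def by (auto simp: insert_commute)
  have ker: "\<pi> u = \<pi> v \<Longrightarrow> (u, v) \<in> ?J" for u v unfolding join_rel_def kernel_rel_def by auto
  show "?K \<subseteq> ?J"
  proof (rule subrelI)
    fix u v assume "(u, v) \<in> ?K"
    then consider "\<pi> u = \<pi> v" | "\<pi> u = \<pi> (t e)" "\<pi> v = \<pi> (s e)" | "\<pi> v = \<pi> (t e)" "\<pi> u = \<pi> (s e)"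
      by (auto simp: kernel_rel_def redirect_def split: if_splits)
    then show "(u, v) \<in> ?J"
      proof cases
      case 1
      then show ?thesis by (rule ker)
    next
      case 2
      then show ?thesis using ker[of u "t e"] ker[of "s e" v] trans st(2) by metis
    next
      case 3
      then show ?thesis using ker[of u "s e"] ker[of "t e" v] trans st(1) by metis
    qed
  qed
qed

lemma range_redirect:
  assumes "a \<in> range \<pi>" "a \<noteq> b"
  shows "range (redirect \<pi> a b) = range \<pi> - {b}"
  using assms by (auto simp: redirect_def image_iff)

lemma redirect_same: "redirect \<pi> a a = \<pi>"
  by (auto simp: redirect_def)

text \<open>
  A new edge merges the two blocks at its ends, or changes nothing if they agree already: on a
  representative map, one value disappears from the range.
\<close>

lemma card_quotient_join_insert:
  fixes r :: "('v::finite \<times> 'v) set"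
  assumes "sym r"
  shows "card (UNIV // join_rel r s t F) =
    card (UNIV // join_rel r s t (insert e F)) + of_bool ((s e, t e) \<notin> join_rel r s t F)"
proof -
  obtain \<pi> where \<pi>: "join_rel r s t F = kernel_rel \<pi>"
    using equiv_eq_kernel_rel[OF equiv_join_rel[OF assms]] .
  show ?thesis
  proof (cases "\<pi> (s e) = \<pi> (t e)")
    case True
    then show ?thesis unfolding join_rel_insert'[of r s t e F] \<pi> join_rel_kernel_rel
      by (simp add: redirect_same) (simp add: kernel_rel_def)
  next
    case False
    have "Suc (card (range \<pi> - {\<pi> (t e)})) = card (range \<pi>)"
      by (rule card_Suc_Diff1) simp_all
    moreover have "range (redirect \<pi> (\<pi> (s e)) (\<pi> (t e))) = range \<pi> - {\<pi> (t e)}"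
      using False by (intro range_redirect) simp_all
    moreover have "(s e, t e) \<notin> kernel_rel \<pi>" using False by (simp add: kernel_rel_def)
    ultimately show ?thesis
      unfolding join_rel_insert'[of r s t e F] \<pi> join_rel_kernel_rel card_quotient_kernel_rel
      by (simp only: of_bool_eq not_False_eq_True add_Suc_right add_0_right One_nat_def)
  qed
qed

lemma card_quotient_join_ge:
  fixes r :: "('v::finite \<times> 'v) set"
  assumes "finite F" "equiv UNIV r"
  shows "card (UNIV // r) \<le> card (UNIV // join_rel r s t F) + card F"
  using assms(1)
proof induction
  case empty
  then show ?case using assms by (simp add: join_rel_empty)
next
  case (insert e F)
  have "sym r" using assms(2) by (meson equivE)
  from card_quotient_join_insert[OF this, of s t F e] insert show ?case
    by (simp add: of_bool_def split: if_splits)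
qed

section \<open>Deletion and contraction for the determinant\<close>

text \<open>
  The matrix on the left is \<open>U A U\<^sup>T\<close> for the elementary matrix \<open>U\<close> that adds row \<open>b\<close> to row
  \<open>a\<close>, so this is one row operation and its transpose.
\<close>

lemma det_congruence_add:
  fixes A :: "'a::comm_ring_1^'n^'n"
  assumes "a \<noteq> b"
  shows "det (\<chi> i j. A$i$j + of_bool (i = a) * A$b$j + of_bool (j = a) * (A$i$b + of_bool (i = a) * A$b$b)) = det A"
proof -
  define B where "B = (\<chi> k. if k = a then row a A + 1 *s row b A else row k A)"
  define C where "C = (\<chi> k. if k = a then row a (transpose B) + 1 *s row b (transpose B) else row k (transpose B))"
  have "det C = det A"
    unfolding C_def det_row_operation[OF assms] det_transpose unfolding B_def det_row_operation[OF assms] ..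
  moreover have "transpose C = (\<chi> i j. A$i$j + of_bool (i = a) * A$b$j + of_bool (j = a) * (A$i$b + of_bool (i = a) * A$b$b))"
    using assms by (auto simp: vec_eq_iff C_def B_def transpose_def row_def)
  ultimately show ?thesis by (metis det_transpose)
qed

text \<open>
  The determinant of this matrix is the principal minor of \<open>A\<close> at \<open>b\<close>. Putting a unit
  row and column there, rather than removing them, leaves the index type unchanged.
\<close>

definition unit_at :: "'n \<Rightarrow> 'a::comm_ring_1^'n^'n \<Rightarrow> 'a^'n^'n" where
  "unit_at b A = (\<chi> i j. if i = b \<or> j = b then of_bool (i = j) else A$i$j)"

text \<open>
  In the Leibniz expansion only permutations that fix \<open>b\<close> contribute, and these see no other
  entry of column \<open>b\<close>.
\<close>

lemma det_unit_row:
  fixes A :: "'a::comm_ring_1^'n^'n"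
  shows "det (\<chi> i. if i = b then axis b 1 else A$i) = det (unit_at b A)"
proof -
  have "(\<Prod>i\<in>UNIV. (\<chi> i. if i = b then axis b 1 else A$i) $ i $ p i) = (\<Prod>i\<in>UNIV. unit_at b A $ i $ p i)"
    if p: "p permutes UNIV" for p
  proof (cases "p b = b")
    case True
    with p have "p i \<noteq> b" if "i \<noteq> b" for i using that by (metis permutes_inj injD)
    then show ?thesis using True by (intro prod.cong) (auto simp: unit_at_def axis_def)
  next
    case False
    then have "\<exists>i\<in>UNIV. (\<chi> i. if i = b then axis b 1 else A$i) $ i $ p i = 0"
      "\<exists>i\<in>UNIV. unit_at b A $ i $ p i = 0"
      by (auto intro!: exI[of _ b] simp: unit_at_def axis_def)
    then show ?thesis by (simp only: prod_zero[OF finite])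
  qed
  then show ?thesis unfolding det_def by (intro sum.cong) auto
qed

lemma det_add_diagonal_entry:
  fixes A :: "'a::comm_ring_1^'n^'n"
  shows "det (\<chi> i j. A$i$j + w * (of_bool (i = b) * of_bool (j = b))) = det A + w * det (unit_at b A)"
proof -
  have "(\<chi> i j. A$i$j + w * (of_bool (i = b) * of_bool (j = b))) = (\<chi> i. if i = b then A$i + w *s axis b 1 else A$i)"
    by (auto simp: vec_eq_iff axis_def)
  also have "det \<dots> = det (\<chi> i. if i = b then A$i else A$i) + det (\<chi> i. if i = b then w *s axis b 1 else A$i)"
    by (rule det_row_add)
  also have "det (\<chi> i. if i = b then w *s axis b 1 else A$i) = w * det (\<chi> i. if i = b then axis b 1 else A$i)"
    by (rule det_row_mul)
  finally show ?thesis by (simp add: det_unit_row)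
qed

text \<open>
  The row and column operation of \<open>det_congruence_add\<close> maps the difference of the unit vectors
  at \<open>a\<close> and \<open>b\<close> to minus the unit vector at \<open>b\<close>, so the rank-one update becomes a change
  of one diagonal entry.
\<close>

lemma det_add_rank_one:
  fixes A :: "'a::comm_ring_1^'n^'n"
  assumes "a \<noteq> b"
  shows "det (\<chi> i j. A$i$j + w * ((of_bool (i = a) - of_bool (i = b)) * (of_bool (j = a) - of_bool (j = b)))) =
    det A + w * det (unit_at b
      (\<chi> i j. A$i$j + of_bool (i = a) * A$b$j + of_bool (j = a) * (A$i$b + of_bool (i = a) * A$b$b)))"
    (is "det ?B = _ + w * det (unit_at b ?N)")
proof -
  have "det ?B = det (\<chi> i j. ?N$i$j + w * (of_bool (i = b) * of_bool (j = b)))"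
    by (subst det_congruence_add[OF assms, symmetric], rule arg_cong[where f = det])
      (use assms in \<open>auto simp: vec_eq_iff of_bool_def algebra_simps\<close>)
  also have "\<dots> = det ?N + w * det (unit_at b ?N)" by (rule det_add_diagonal_entry)
  finally show ?thesis by (simp add: det_congruence_add[OF assms])
qed

text \<open>
  This is \<open>diag x + \<Sum>\<^sub>e w\<^sub>e b\<^sub>e b\<^sub>e\<^sup>T\<close> for the graph contracted along \<open>\<pi>\<close>: the vertices are
  the elements of \<open>range \<pi>\<close>, and each one collects the \<open>x\<close>-weight of its block. The last
  summand is an identity block on the remaining indices, which leaves the determinant unaffected.
\<close>

definition contracted_laplacian ::
  "('v::finite \<Rightarrow> 'a::comm_ring_1) \<Rightarrow> ('e \<Rightarrow> 'a) \<Rightarrow> ('e \<Rightarrow> 'v) \<Rightarrow> ('e \<Rightarrow> 'v) \<Rightarrow> ('v \<Rightarrow> 'v) \<Rightarrow> 'e set \<Rightarrow> 'a^'v^'v" where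
  "contracted_laplacian x w s t \<pi> E = (\<chi> i j.
     (\<Sum>u\<in>UNIV. x u * (of_bool (\<pi> u = i) * of_bool (\<pi> u = j))) +
     (\<Sum>e\<in>E. w e * ((of_bool (\<pi> (s e) = i) - of_bool (\<pi> (t e) = i)) *
                    (of_bool (\<pi> (s e) = j) - of_bool (\<pi> (t e) = j)))) +
     of_bool (i = j \<and> i \<notin> range \<pi>))"

text \<open>
  Adding row \<open>b\<close> to row \<open>a\<close> and likewise for columns, and then discarding \<open>b\<close>, identifies the
  two vertices: for \<open>i \<noteq> b\<close>, the indicator of \<open>i\<close> under the redirected map is the old
  indicator of \<open>i\<close>, plus that of \<open>b\<close> in case \<open>i = a\<close>. The matrix is bilinear in these
  indicators.
\<close>

lemma unit_at_contracted_laplacian: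
  fixes x :: "'v::finite \<Rightarrow> 'a::comm_ring_1"
  assumes ab: "a \<in> range \<pi>" "b \<in> range \<pi>" "a \<noteq> b"
    and A_def: "A = contracted_laplacian x w s t \<pi> E"
  shows "unit_at b (\<chi> i j. A$i$j + of_bool (i = a) * A$b$j + of_bool (j = a) * (A$i$b + of_bool (i = a) * A$b$b))
    = contracted_laplacian x w s t (redirect \<pi> a b) E" (is "?L = ?R")
proof -
  define q where "q = (\<lambda>u i. of_bool (\<pi> u = i) :: 'a)"
  define q' where "q' = (\<lambda>u i. of_bool (redirect \<pi> a b u = i) :: 'a)"
  have q': "q' u i = q u i + of_bool (i = a) * q u b" if "i \<noteq> b" for u i
    using that ab by (auto simp: q_def q'_def redirect_def)
  have q'b: "q' u b = 0" for u using ab by (auto simp: q'_def redirect_def)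
  have A: "A $ i $ j = (\<Sum>u\<in>UNIV. x u * (q u i * q u j)) +
     (\<Sum>e\<in>E. w e * ((q (s e) i - q (t e) i) * (q (s e) j - q (t e) j))) + of_bool (i = j \<and> i \<notin> range \<pi>)" for i j
    by (simp add: A_def contracted_laplacian_def q_def)
  have R: "?R $ i $ j = (\<Sum>u\<in>UNIV. x u * (q' u i * q' u j)) +
     (\<Sum>e\<in>E. w e * ((q' (s e) i - q' (t e) i) * (q' (s e) j - q' (t e) j))) + of_bool (i = j \<and> i \<notin> range \<pi> - {b})" for i j
    by (simp add: contracted_laplacian_def q'_def range_redirect[OF ab(1,3)])
  have "?L $ i $ j = ?R $ i $ j" for i j
  proof (cases "i = b \<or> j = b")
    case True
    then show ?thesis using q'b by (auto simp: unit_at_def R)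
  next
    case False
    then have "i \<noteq> b" "j \<noteq> b" by auto
    have 1: "(\<Sum>u\<in>UNIV. x u * (q' u i * q' u j)) = (\<Sum>u\<in>UNIV. x u * (q u i * q u j))
      + of_bool (i = a) * (\<Sum>u\<in>UNIV. x u * (q u b * q u j)) + of_bool (j = a) * ((\<Sum>u\<in>UNIV. x u * (q u i * q u b))
      + of_bool (i = a) * (\<Sum>u\<in>UNIV. x u * (q u b * q u b)))"
      unfolding q'[OF \<open>i \<noteq> b\<close>] q'[OF \<open>j \<noteq> b\<close>] sum_distrib_left sum.distrib[symmetric]
      by (intro sum.cong) (simp_all add: algebra_simps)
    have 2: "(\<Sum>e\<in>E. w e * ((q' (s e) i - q' (t e) i) * (q' (s e) j - q' (t e) j))) =
      (\<Sum>e\<in>E. w e * ((q (s e) i - q (t e) i) * (q (s e) j - q (t e) j)))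
      + of_bool (i = a) * (\<Sum>e\<in>E. w e * ((q (s e) b - q (t e) b) * (q (s e) j - q (t e) j)))
      + of_bool (j = a) * ((\<Sum>e\<in>E. w e * ((q (s e) i - q (t e) i) * (q (s e) b - q (t e) b)))
      + of_bool (i = a) * (\<Sum>e\<in>E. w e * ((q (s e) b - q (t e) b) * (q (s e) b - q (t e) b))))"
      unfolding q'[OF \<open>i \<noteq> b\<close>] q'[OF \<open>j \<noteq> b\<close>] sum_distrib_left sum.distrib[symmetric]
      by (intro sum.cong) (simp_all add: algebra_simps)
    have 3: "?L $ i $ j = A$i$j + of_bool (i = a) * A$b$j + of_bool (j = a) * (A$i$b + of_bool (i = a) * A$b$b)"
      using False by (simp add: unit_at_def)
    show ?thesis unfolding 3 unfolding R 1 2 A using False ab by (simp add: algebra_simps)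
  qed
  then show ?thesis by (simp add: vec_eq_iff)
qed

lemma det_contracted_laplacian_insert:
  fixes x :: "'v::finite \<Rightarrow> 'a::comm_ring_1"
  assumes "finite E" "e \<notin> E" "\<pi> (s e) \<noteq> \<pi> (t e)"
  shows "det (contracted_laplacian x w s t \<pi> (insert e E)) =
    det (contracted_laplacian x w s t \<pi> E) +
    w e * det (contracted_laplacian x w s t (redirect \<pi> (\<pi> (s e)) (\<pi> (t e))) E)"
proof -
  let ?a = "\<pi> (s e)" and ?b = "\<pi> (t e)"
  let ?A = "contracted_laplacian x w s t \<pi> E"
  have "contracted_laplacian x w s t \<pi> (insert e E) =
    (\<chi> i j. ?A$i$j + w e * ((of_bool (i = ?a) - of_bool (i = ?b)) * (of_bool (j = ?a) - of_bool (j = ?b))))"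
    using assms by (simp add: vec_eq_iff contracted_laplacian_def algebra_simps eq_commute)
  then show ?thesis
    by (simp only: det_add_rank_one[OF assms(3)] unit_at_contracted_laplacian[OF rangeI[of \<pi> "s e"] rangeI[of \<pi> "t e"] assms(3) refl])
qed

lemma contracted_laplacian_insert_loop:
  assumes "\<pi> (s e) = \<pi> (t e)"
  shows "contracted_laplacian x w s t \<pi> (insert e E) = contracted_laplacian x w s t \<pi> E"
proof (cases "finite E")
  case True
  then show ?thesis using assms
    by (cases "e \<in> E") (simp_all add: contracted_laplacian_def insert_absorb)
qed (simp add: contracted_laplacian_def)

lemma det_contracted_laplacian_empty:
  "det (contracted_laplacian x w s t \<pi> {}) = (\<Prod>T\<in>UNIV // kernel_rel \<pi>. \<Sum>u\<in>T. x u)"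
proof -
  let ?A = "contracted_laplacian x w s t \<pi> {}"
  have "det ?A = (\<Prod>i\<in>UNIV. ?A $ i $ i)"
    by (rule det_diagonal) (auto simp: contracted_laplacian_def intro!: sum.neutral)
  also have "\<dots> = (\<Prod>i\<in>range \<pi>. ?A $ i $ i)"
    by (rule prod.mono_neutral_right) (auto simp: contracted_laplacian_def intro!: sum.neutral)
  also have "\<dots> = (\<Prod>i\<in>range \<pi>. \<Sum>u\<in>\<pi> -` {i}. x u)"
  proof (rule prod.cong[OF refl])
    fix i assume "i \<in> range \<pi>"
    then have "?A $ i $ i = (\<Sum>u\<in>UNIV. if \<pi> u = i then x u else 0)"
      by (auto simp: contracted_laplacian_def intro!: sum.cong)
    also have "\<dots> = (\<Sum>u\<in>\<pi> -` {i}. x u)"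
      by (simp add: sum.If_cases vimage_def)
    finally show "?A $ i $ i = (\<Sum>u\<in>\<pi> -` {i}. x u)" .
  qed
  also have "\<dots> = (\<Prod>T\<in>UNIV // kernel_rel \<pi>. \<Sum>u\<in>T. x u)"
    by (simp add: quotient_kernel_rel prod.reindex[OF inj_on_fibre])
  finally show ?thesis .
qed

section \<open>Relative forests\<close>

text \<open>
  Every edge lowers the number of blocks by at most one, so the equation says that each edge of
  \<open>F\<close> lowers it by exactly one, in whatever order the edges are added. For an equivalence
  relation \<open>r\<close> this describes the forests of the graph in which the blocks of \<open>r\<close> have been
  contracted.
\<close>

definition relative_forests ::
  "('e \<Rightarrow> 'v::finite) \<Rightarrow> ('e \<Rightarrow> 'v) \<Rightarrow> ('v \<times> 'v) set \<Rightarrow> 'e set \<Rightarrow> 'e set set" where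
  "relative_forests s t r E =
     {F. F \<subseteq> E \<and> card (UNIV // join_rel r s t F) + card F = card (UNIV // r)}"

lemma relative_forests_empty:
  "equiv UNIV r \<Longrightarrow> relative_forests s t r {} = {{}}"
  by (auto simp: relative_forests_def join_rel_empty)

lemma finite_relative_forests: "finite E \<Longrightarrow> finite (relative_forests s t r E)"
  by (simp add: relative_forests_def)

text \<open>
  If \<open>e\<close> joins two blocks of \<open>r\<close>, the forests that contain \<open>e\<close> are those of the contraction by
  \<open>e\<close>, since both counts drop by one. If it does not, no forest contains \<open>e\<close>: the other edges
  cannot make up for the block that \<open>e\<close> fails to merge.
\<close>

lemma relative_forests_insert:
  assumes "finite E" "e \<notin> E" "equiv UNIV r"
  shows "relative_forests s t r (insert e E) = relative_forests s t r E \<union>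
    (if (s e, t e) \<in> r then {} else insert e ` relative_forests s t (join_rel r s t {e}) E)"
    (is "?L = ?R")
proof -
  let ?r' = "join_rel r s t {e}"
  have "sym r" using assms(3) by (meson equivE)
  have step: "card (UNIV // r) = card (UNIV // ?r') + of_bool ((s e, t e) \<notin> r)"
    using card_quotient_join_insert[OF \<open>sym r\<close>, of s t "{}" e] by (simp add: join_rel_empty assms)
  have key: "insert e F \<in> ?L \<longleftrightarrow> (s e, t e) \<notin> r \<and> F \<in> relative_forests s t ?r' E" if "F \<subseteq> E" for F
  proof -
    have fin: "finite F" "e \<notin> F" using that assms finite_subset by auto
    have "card (UNIV // ?r') \<le> card (UNIV // join_rel ?r' s t F) + card F"
      by (rule card_quotient_join_ge[OF fin(1) equiv_join_rel[OF \<open>sym r\<close>]])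
    then show ?thesis using fin that step
      by (auto simp: relative_forests_def join_rel_insert[of r s t e F])
  qed
  show ?thesis
  proof (rule set_eqI)
    fix F
    show "F \<in> ?L \<longleftrightarrow> F \<in> ?R"
    proof (cases "e \<in> F")
      case False
      then show ?thesis by (auto simp: relative_forests_def)
    next
      case True
      then obtain F' where F: "F = insert e F'" "e \<notin> F'" by (metis mk_disjoint_insert)
      have "F \<in> ?R \<longleftrightarrow> (s e, t e) \<notin> r \<and> F' \<in> relative_forests s t ?r' E"
      proof -
        have "F \<notin> relative_forests s t r E" using True assms(2) by (auto simp: relative_forests_def)
        moreover have "F \<in> insert e ` relative_forests s t ?r' E \<longleftrightarrow> F' \<in> relative_forests s t ?r' E"
        proof
          assume "F \<in> insert e ` relative_forests s t ?r' E"
          then obtain H where H: "F = insert e H" "H \<in> relative_forests s t ?r' E" by auto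
          then have "e \<notin> H" using assms(2) by (auto simp: relative_forests_def)
          with H F have "H = F'" by (metis insert_ident)
          with H show "F' \<in> relative_forests s t ?r' E" by simp
        qed (use F in auto)
        ultimately show ?thesis by auto
      qed
      moreover have "F \<in> ?L \<Longrightarrow> F' \<subseteq> E" using F by (auto simp: relative_forests_def)
      moreover have "F' \<in> relative_forests s t ?r' E \<Longrightarrow> F' \<subseteq> E" by (auto simp: relative_forests_def)
      ultimately show ?thesis using key F by blast
    qed
  qed
qed

text \<open>
  The deletion-contraction recursions of the determinant and of the relative forests agree. The
  map \<open>\<pi>\<close> has to be arbitrary in the induction on the edge set, because contraction changes it.
\<close>

lemma det_contracted_laplacian:
  fixes x :: "'v::finite \<Rightarrow> 'a::comm_ring_1"
  assumes "finite E"
  shows "det (contracted_laplacian x w s t \<pi> E) =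
    (\<Sum>F\<in>relative_forests s t (kernel_rel \<pi>) E.
      (\<Prod>e\<in>F. w e) * (\<Prod>T\<in>UNIV // join_rel (kernel_rel \<pi>) s t F. \<Sum>u\<in>T. x u))"
  using assms
proof (induction E arbitrary: \<pi>)
  case empty
  show ?case
    by (simp add: det_contracted_laplacian_empty relative_forests_empty join_rel_empty equiv_kernel_rel)
next
  case (insert e E)
  let ?r = "kernel_rel \<pi>" and ?\<pi>' = "redirect \<pi> (\<pi> (s e)) (\<pi> (t e))"
  let ?wt = "\<lambda>r F. (\<Prod>e\<in>F. w e) * (\<Prod>T\<in>UNIV // join_rel r s t F. \<Sum>u\<in>T. x u)"
  have kernel_iff: "(s e, t e) \<in> ?r \<longleftrightarrow> \<pi> (s e) = \<pi> (t e)" by (simp add: kernel_rel_def)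
  note split = relative_forests_insert[OF insert(1,2) equiv_kernel_rel, of s t \<pi>]
  show ?case
  proof (cases "\<pi> (s e) = \<pi> (t e)")
    case True
    then show ?thesis
      unfolding split using insert.IH kernel_iff by (simp add: contracted_laplacian_insert_loop)
  next
    case False
    have no_e: "e \<notin> F" if "F \<in> relative_forests s t r E" for r F
      using that insert(2) by (auto simp: relative_forests_def)
    have "relative_forests s t ?r (insert e E) =
      relative_forests s t ?r E \<union> insert e ` relative_forests s t (kernel_rel ?\<pi>') E"
      unfolding split join_rel_kernel_rel using False kernel_iff by simp
    moreover have "sum (?wt ?r) (insert e ` relative_forests s t (kernel_rel ?\<pi>') E) =
      w e * sum (?wt (kernel_rel ?\<pi>')) (relative_forests s t (kernel_rel ?\<pi>') E)"
    proof -
      have "inj_on (insert e) (relative_forests s t (kernel_rel ?\<pi>') E)"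
        using no_e by (meson inj_onI insert_ident)
      moreover have "?wt ?r (insert e F) = w e * ?wt (kernel_rel ?\<pi>') F"
        if "F \<in> relative_forests s t (kernel_rel ?\<pi>') E" for F
      proof -
        have "finite F" using that insert(1) by (auto simp: relative_forests_def intro: finite_subset)
        then show ?thesis using no_e[OF that]
          by (simp add: join_rel_insert[of ?r s t e F] join_rel_kernel_rel mult.assoc)
      qed
      ultimately show ?thesis by (simp add: sum.reindex sum_distrib_left)
    qed
    moreover have "relative_forests s t ?r E \<inter> insert e ` relative_forests s t (kernel_rel ?\<pi>') E = {}"
      using no_e by blast
    ultimately show ?thesis
      by (simp add: det_contracted_laplacian_insert[where \<pi> = \<pi> and s = s and t = t, OF insert(1,2) False] insert.IH
          sum.union_disjoint finite_relative_forests insert(1))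
  qed
qed

section \<open>Cycles and component counts\<close>

lemma connected_rel_eq_join_rel:
  assumes "\<And>e. e \<in> F \<Longrightarrow> ends g e = {s e, t e}"
  shows "connected_rel g F = join_rel Id s t F"
proof -
  have "{(u, v). \<exists>e\<in>F. ends g e = {u, v}} = link s t F"
    using assms by (auto simp: link_def)
  then show ?thesis
    using rtrancl_absorb[of "{}" "link s t F"] by (simp add: connected_rel_def join_rel_def)
qed

lemma connected_rel_simple_path:
  assumes "(u, v) \<in> connected_rel g F"
  shows "\<exists>vs es. distinct vs \<and> length vs = Suc (length es) \<and> vs ! 0 = u \<and> vs ! length es = v \<and>
    set es \<subseteq> F \<and> (\<forall>i<length es. ends g (es ! i) = {vs ! i, vs ! Suc i})"
  using assms unfolding connected_rel_def
proof (induction rule: rtrancl_induct)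
  case base
  show ?case by (rule exI[of _ "[u]"], rule exI[of _ "[]"]) simp
next
  case (step y z)
  then obtain vs es where p: "distinct vs" "length vs = Suc (length es)" "vs ! 0 = u" "vs ! length es = y"
    "set es \<subseteq> F" "\<forall>i<length es. ends g (es ! i) = {vs ! i, vs ! Suc i}" by blast
  from step.hyps(2) obtain f where f: "f \<in> F" "ends g f = {y, z}" by auto
  show ?case
  proof (cases "z \<in> set vs")
    case True
    \<comment> \<open>The walk returns to a visited vertex, so the path is cut back to that vertex.\<close>
    then obtain k where k: "k < length vs" "vs ! k = z" by (metis in_set_conv_nth)
    show ?thesis
      by (rule exI[of _ "take (Suc k) vs"], rule exI[of _ "take k es"])
        (use p k set_take_subset[of k es] in auto)
  next
    case False
    show ?thesis
      by (rule exI[of _ "vs @ [z]"], rule exI[of _ "es @ [f]"])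
        (use p f False in \<open>auto simp: nth_append less_Suc_eq\<close>)
  qed
qed

text \<open>The edge \<open>e\<close> closes a simple path between its ends. Loops are covered by the empty path.\<close>

lemma cycle_of_connected_ends:
  assumes "(u, v) \<in> connected_rel g F" "ends g e = {u, v}" "e \<notin> F"
  shows "\<exists>vs es. is_cycle g (insert e F) vs es"
proof -
  from connected_rel_simple_path[OF assms(1)] obtain vs es where
    p: "distinct vs" "length vs = Suc (length es)" "vs ! 0 = u" "vs ! length es = v"
      "set es \<subseteq> F" "\<forall>i<length es. ends g (es ! i) = {vs ! i, vs ! Suc i}" by blast
  \<comment> \<open>An edge determines its ends, so an edge used twice would repeat a vertex.\<close>
  have "es ! i \<noteq> es ! j" if "i < j" "j < length es" for i j
  proof
    assume "es ! i = es ! j"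
    then have "vs ! i \<in> {vs ! j, vs ! Suc j}" using p(6) that by (metis insertI1 order.strict_trans)
    then show False using p(1,2) that by (auto simp: nth_eq_iff_index_eq)
  qed
  then have "distinct es" unfolding distinct_conv_nth by (metis nat_neq_iff)
  moreover have "ends g ((es @ [e]) ! i) = {vs ! i, vs ! (Suc i mod Suc (length es))}"
    if "i < Suc (length es)" for i
  proof (cases "i = length es")
    case True
    then show ?thesis using p(3,4) assms(2) by (simp add: insert_commute)
  next
    case False
    then show ?thesis using that p(6) by (simp add: nth_append mod_less)
  qed
  ultimately have "is_cycle g (insert e F) vs (es @ [e])"
    using p(1,2,5) assms(3) by (auto simp: is_cycle_def)
  then show ?thesis by blast
qed

text \<open>
  The edge to remove is the last one: the rest of the cycle is then already listed as a path from
  the first vertex to the last.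
\<close>

lemma connected_ends_of_cycle:
  assumes "is_cycle g F vs es"
  obtains e u v where "e \<in> F" "ends g e = {u, v}" "(u, v) \<in> connected_rel g (F - {e})"
proof -
  define m where "m = length es - 1"
  have len: "length es = Suc m" "length vs = Suc m" using assms by (auto simp: is_cycle_def m_def)
  have ends: "i < Suc m \<Longrightarrow> ends g (es ! i) = {vs ! i, vs ! (Suc i mod Suc m)}" for i
    using assms len by (auto simp: is_cycle_def)
  have "i \<le> m \<Longrightarrow> (vs ! 0, vs ! i) \<in> connected_rel g (F - {es ! m})" for i
  proof (induction i)
    case 0
    then show ?case by (simp add: connected_rel_def)
  next
    case (Suc i)
    then have "ends g (es ! i) = {vs ! i, vs ! Suc i}" using ends[of i] by simp
    moreover have "es ! i \<in> F - {es ! m}" using assms len Suc.prems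
      by (auto simp: is_cycle_def nth_eq_iff_index_eq subset_iff)
    ultimately have "(vs ! i, vs ! Suc i) \<in> {(u, v). \<exists>e\<in>F - {es ! m}. ends g e = {u, v}}" by blast
    then show ?case using Suc unfolding connected_rel_def by (simp add: rtrancl.rtrancl_into_rtrancl)
  qed
  then have "(vs ! 0, vs ! m) \<in> connected_rel g (F - {es ! m})" by simp
  moreover have "ends g (es ! m) = {vs ! 0, vs ! m}" using ends[of m] by (simp add: insert_commute)
  moreover have "es ! m \<in> F" using assms len by (auto simp: is_cycle_def)
  ultimately show thesis using that by blast
qed

text \<open>
  Without cycles, every added edge joins two components. Conversely, an edge of a cycle can be
  removed without changing the number of components, and the remaining edges are too few to bring
  that number down to \<open>CARD('v) - card F\<close>.
\<close>

lemma acyclic_iff_card_components: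
  fixes g :: "('v::finite, 'e) weighted_multigraph"
  assumes "finite F" and ends: "\<And>e. e \<in> F \<Longrightarrow> ends g e = {s e, t e}"
  shows "(\<nexists>vs es. is_cycle g F vs es) \<longleftrightarrow>
    card (UNIV // join_rel Id s t F) + card F = CARD('v)"
proof
  {
    assume "\<nexists>vs es. is_cycle g F vs es"
    with assms show "card (UNIV // join_rel Id s t F) + card F = CARD('v)"
    proof (induction F)
      case empty
      then show ?case by (simp add: card_quotient_Id equiv_Id join_rel_empty)
    next
      case (insert e F)
      have "\<nexists>vs es. is_cycle g F vs es"
        using insert.prems(2) unfolding is_cycle_def by (meson subset_insertI subset_trans)
      then have "card (UNIV // join_rel Id s t F) + card F = CARD('v)"
        using insert by simp
      moreover have "(s e, t e) \<notin> connected_rel g F"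
        using cycle_of_connected_ends[of "s e" "t e" g F e] insert by auto
      then have "(s e, t e) \<notin> join_rel Id s t F"
        using connected_rel_eq_join_rel[of F g s t] insert.prems(1) by auto
      ultimately show ?case
        using card_quotient_join_insert[OF sym_Id, of s t F e] insert.hyps by simp
    qed
  next
    assume card: "card (UNIV // join_rel Id s t F) + card F = CARD('v)"
    show "\<nexists>vs es. is_cycle g F vs es"
    proof
      assume "\<exists>vs es. is_cycle g F vs es"
      then obtain e u v where e: "e \<in> F" "ends g e = {u, v}" "(u, v) \<in> connected_rel g (F - {e})"
        using connected_ends_of_cycle by metis
      have eq: "connected_rel g (F - {e}) = join_rel Id s t (F - {e})"
        using ends by (intro connected_rel_eq_join_rel) auto
      have "{u, v} = {s e, t e}" using ends[OF e(1)] e(2) by simp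
      then have "(s e, t e) \<in> join_rel Id s t (F - {e})"
        using e(3) equiv_join_rel[OF sym_Id, of s t "F - {e}"]
        unfolding eq by (auto simp: doubleton_eq_iff dest: equivE symD)
      then have "card (UNIV // join_rel Id s t (F - {e})) = card (UNIV // join_rel Id s t F)"
        using card_quotient_join_insert[OF sym_Id, of s t "F - {e}" e] e(1) by (simp add: insert_absorb)
      moreover have "CARD('v) \<le> card (UNIV // join_rel Id s t (F - {e})) + card (F - {e})"
        using card_quotient_join_ge[OF _ equiv_Id, of "F - {e}" s t] assms(1) by (simp add: card_quotient_Id)
      moreover have "card F = Suc (card (F - {e}))" by (rule card_Suc_Diff1[OF assms(1) e(1), symmetric])
      ultimately show False using card by linarith
    qed
  }
qed

section \<open>The Laplacian polynomial\<close>

lemma laplacian_eq_sum_rank_one: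
  fixes g :: "('v::finite, 'e) weighted_multigraph"
  assumes "finite (edges g)" and ends: "\<And>e. e \<in> edges g \<Longrightarrow> ends g e = {s e, t e}"
  shows "laplacian g $ u $ v = (\<Sum>e\<in>edges g. ewt g e *
    ((of_bool (s e = u) - of_bool (t e = u)) * (of_bool (s e = v) - of_bool (t e = v))))"
proof -
  \<comment> \<open>The contribution of \<open>e\<close> to the adjacency matrix; it is \<open>2\<close> at the vertex of a loop.\<close>
  define a :: "'e \<Rightarrow> 'v \<Rightarrow> 'v \<Rightarrow> real" where
    "a = (\<lambda>e u v. of_bool (s e = u) * of_bool (t e = v) + of_bool (t e = u) * of_bool (s e = v))"
  have tot: "total_ewt g u v = (\<Sum>e\<in>edges g. ewt g e * a e u v)" for u v
  proof -
    have "total_ewt g u v = (\<Sum>e\<in>edges g. if ends g e = {u, v} then (if u = v then 2 * ewt g e else ewt g e) else 0)"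
      unfolding total_ewt_def by (rule sum.inter_filter[OF assms(1)])
    also have "\<dots> = (\<Sum>e\<in>edges g. ewt g e * a e u v)"
      by (rule sum.cong) (auto simp: ends a_def doubleton_eq_iff of_bool_def)
    finally show ?thesis .
  qed
  have deg: "wdegree g u = (\<Sum>e\<in>edges g. ewt g e * (of_bool (s e = u) + of_bool (t e = u)))"
  proof -
    have "(\<Sum>v\<in>UNIV. a e u v) = of_bool (s e = u) + of_bool (t e = u)" for e
      by (simp add: a_def sum.distrib flip: sum_distrib_left)
    then show ?thesis
      unfolding wdegree_def tot by (subst sum.swap) (simp flip: sum_distrib_left)
  qed
  have "laplacian g $ u $ v = of_bool (u = v) * wdegree g u - total_ewt g u v"
    by (simp add: laplacian_def degree_matrix_def adjacency_matrix_def)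
  also have "\<dots> = (\<Sum>e\<in>edges g. of_bool (u = v) * (ewt g e * (of_bool (s e = u) + of_bool (t e = u))) - ewt g e * a e u v)"
    by (simp only: deg tot sum_distrib_left sum_subtractf)
  also have "\<dots> = (\<Sum>e\<in>edges g. ewt g e *
    ((of_bool (s e = u) - of_bool (t e = u)) * (of_bool (s e = v) - of_bool (t e = v))))"
    by (rule sum.cong) (auto simp: a_def of_bool_def)
  finally show ?thesis .
qed

text \<open>Every edge of \<open>F\<close> lies in exactly one component, namely that of its end \<open>s e\<close>.\<close>

lemma forest_weight_eq:
  fixes g :: "('v::finite, 'e) weighted_multigraph"
  assumes "finite F" and ends: "\<And>e. e \<in> F \<Longrightarrow> ends g e = {s e, t e}"
  shows "forest_weight g F = (\<Prod>e\<in>F. ewt g e) * (\<Prod>T\<in>components_of g F. \<Sum>v\<in>T. vwt g v)"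
proof -
  let ?R = "connected_rel g F"
  have R: "?R = join_rel Id s t F" by (rule connected_rel_eq_join_rel[OF ends])
  have eq: "equiv UNIV ?R" unfolding R by (rule equiv_join_rel[OF sym_Id])
  have "component_edges g F T = {e \<in> F. ?R `` {s e} = T}"
    if T_comp: "T \<in> components_of g F" for T
  proof -
    obtain z where T: "T = ?R `` {z}" using T_comp unfolding components_of_def by (auto elim: quotientE)
    have "ends g e \<subseteq> T \<longleftrightarrow> ?R `` {s e} = T" if "e \<in> F" for e
    proof -
      have "(s e, t e) \<in> ?R" using that ends unfolding connected_rel_def by blast
      then have "?R `` {s e} = ?R `` {t e}" by (rule equiv_class_eq[OF eq])
      moreover have "v \<in> T \<longleftrightarrow> ?R `` {v} = T" for v
        using equiv_class_eq_iff[OF eq, of z v] unfolding T by auto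
      ultimately show ?thesis using ends[OF that] by simp
    qed
    then show ?thesis by (auto simp: component_edges_def)
  qed
  then have "(\<Prod>T\<in>components_of g F. \<Prod>e\<in>component_edges g F T. ewt g e) =
    (\<Prod>T\<in>components_of g F. prod (ewt g) {e \<in> F. ?R `` {s e} = T})" by simp
  also have "\<dots> = prod (ewt g) F"
    by (rule prod.group[OF assms(1)]) (auto simp: components_of_def quotientI)
  finally show ?thesis by (simp add: forest_weight_def prod.distrib mult.commute)
qed

lemma spanning_forests_eq:
  fixes g :: "('v::finite, 'e) weighted_multigraph"
  assumes "finite (edges g)" and ends: "\<And>e. e \<in> edges g \<Longrightarrow> ends g e = {s e, t e}"
  shows "spanning_forests g k = {F \<in> relative_forests s t Id (edges g). card (components_of g F) = k}"
proof -
  have "is_spanning_forest g F \<longleftrightarrow> F \<in> relative_forests s t Id (edges g)" for F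
  proof (cases "F \<subseteq> edges g")
    case True
    then have "finite F" "\<And>e. e \<in> F \<Longrightarrow> ends g e = {s e, t e}" using assms finite_subset by auto
    from acyclic_iff_card_components[OF this] True show ?thesis
      by (simp add: is_spanning_forest_def relative_forests_def card_quotient_Id)
  qed (simp add: is_spanning_forest_def relative_forests_def)
  then show ?thesis by (simp add: spanning_forests_def)
qed

text \<open>
  The polynomial is the determinant for the discrete partition, with vertex weights \<open>\<upsilon>(v) X\<close> and
  edge weights \<open>- \<epsilon>(e)\<close>; the forests are then collected by their number of components.
\<close>

lemma laplacian_poly_eq_forest_sum:
  fixes g :: "('v::finite, 'e) weighted_multigraph"
  assumes "wf_weighted_multigraph g"
  shows "laplacian_poly g = (\<Sum>k=1..CARD('v).
    monom ((-1) ^ (CARD('v) - k) * (\<Sum>F\<in>spanning_forests g k. forest_weight g F)) k)"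
proof -
  let ?n = "CARD('v)" and ?E = "edges g"
  have fin: "finite ?E" using assms by (simp add: wf_weighted_multigraph_def)
  have "\<forall>e\<in>?E. \<exists>p. ends g e = {fst p, snd p}" using assms by (auto simp: wf_weighted_multigraph_def)
  then obtain p where p: "\<forall>e\<in>?E. ends g e = {fst (p e), snd (p e)}" by metis
  define s t where "s = (\<lambda>e. fst (p e))" and "t = (\<lambda>e. snd (p e))"
  have ends: "\<And>e. e \<in> ?E \<Longrightarrow> ends g e = {s e, t e}" using p by (simp add: s_def t_def)
  define x where "x = (\<lambda>v. [:0, vwt g v:])"
  define w where "w = (\<lambda>e. [:- ewt g e:])"
  let ?S = "relative_forests s t Id ?E"
  have "(\<chi> u v. [:0, 1:] * [:vwt_matrix g $ u $ v:] - [:laplacian g $ u $ v:]) = contracted_laplacian x w s t id ?E"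
  proof -
    have "contracted_laplacian x w s t id ?E $ u $ v = [:0, 1:] * [:vwt_matrix g $ u $ v:] - [:laplacian g $ u $ v:]" for u v
    proof -
      have "(\<Sum>z\<in>UNIV. x z * (of_bool (z = u) * of_bool (z = v))) = (\<Sum>z\<in>UNIV. if z = u then x u * of_bool (u = v) else 0)"
        by (rule sum.cong) auto
      then have 1: "(\<Sum>z\<in>UNIV. x z * (of_bool (z = u) * of_bool (z = v))) = [:0, 1:] * [:vwt_matrix g $ u $ v:]"
        by (simp add: x_def vwt_matrix_def)
      let ?\<beta> = "\<lambda>e. (of_bool (s e = u) - of_bool (t e = u)) * (of_bool (s e = v) - of_bool (t e = v))"
      have "(\<Sum>e\<in>A. w e * ?\<beta> e) = - [:\<Sum>e\<in>A. ewt g e * ?\<beta> e:]" if "finite A" for A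
        using that by induction (auto simp: w_def of_bool_def)
      from this[OF fin] have 2: "(\<Sum>e\<in>?E. w e * ?\<beta> e) = - [:laplacian g $ u $ v:]"
        by (simp only: laplacian_eq_sum_rank_one[OF fin ends])
      from 1 2 show ?thesis by (simp add: contracted_laplacian_def)
    qed
    then show ?thesis by (simp add: vec_eq_iff)
  qed
  then have "laplacian_poly g = (\<Sum>F\<in>?S. (\<Prod>e\<in>F. w e) * (\<Prod>T\<in>UNIV // join_rel Id s t F. \<Sum>u\<in>T. x u))"
    by (simp only: laplacian_poly_def det_contracted_laplacian[OF fin] kernel_rel_id)
  also have "\<dots> = (\<Sum>F\<in>?S. monom ((-1) ^ (?n - card (components_of g F)) * forest_weight g F) (card (components_of g F)))"
  proof (rule sum.cong[OF refl])
    fix F assume F: "F \<in> ?S"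
    then have "F \<subseteq> ?E" by (auto simp: relative_forests_def)
    then have FE: "finite F" "\<And>e. e \<in> F \<Longrightarrow> ends g e = {s e, t e}" using fin ends finite_subset by auto
    have comp: "components_of g F = UNIV // join_rel Id s t F"
      by (simp add: components_of_def connected_rel_eq_join_rel[OF FE(2)])
    have "card F = ?n - card (components_of g F)"
      using F unfolding relative_forests_def comp card_quotient_Id mem_Collect_eq by linarith
    moreover have "(\<Prod>e\<in>F. w e) = monom ((-1) ^ card F * (\<Prod>e\<in>F. ewt g e)) 0"
      using FE(1) by induction (simp_all add: w_def monom_0)
    moreover have "(\<Prod>T\<in>\<C>. \<Sum>u\<in>T. x u) = monom (\<Prod>T\<in>\<C>. \<Sum>u\<in>T. vwt g u) (card \<C>)" for \<C> :: "'v set set"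
    proof -
      have "(\<Sum>u\<in>T. x u) = monom (\<Sum>u\<in>T. vwt g u) 1" for T
      proof -
        have "(\<Sum>u\<in>T. x u) = (\<Sum>u\<in>T. monom (vwt g u) 1)" by (simp add: x_def monom_Suc monom_0)
        then show ?thesis by (simp add: monom_sum)
      qed
      moreover have "finite \<C>" by simp
      then have "(\<Prod>T\<in>\<C>. monom (\<Sum>u\<in>T. vwt g u) 1) = monom (\<Prod>T\<in>\<C>. \<Sum>u\<in>T. vwt g u) (card \<C>)"
        by induction (simp_all add: mult_monom)
      ultimately show ?thesis by simp
    qed
    ultimately show "(\<Prod>e\<in>F. w e) * (\<Prod>T\<in>UNIV // join_rel Id s t F. \<Sum>u\<in>T. x u) =
      monom ((-1) ^ (?n - card (components_of g F)) * forest_weight g F) (card (components_of g F))"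
      by (simp add: forest_weight_eq[OF FE] mult_monom comp mult.assoc)
  qed
  also have "\<dots> = (\<Sum>k=1..?n. \<Sum>F | F \<in> ?S \<and> card (components_of g F) = k.
    monom ((-1) ^ (?n - card (components_of g F)) * forest_weight g F) (card (components_of g F)))"
  proof (rule sum.group[symmetric])
    show "(\<lambda>F. card (components_of g F)) ` ?S \<subseteq> {1..?n}"
    proof clarify
      fix F assume F: "F \<in> ?S"
      have "components_of g F = UNIV // join_rel Id s t F"
        using F ends by (subst components_of_def, subst connected_rel_eq_join_rel) (auto simp: relative_forests_def)
      then have "card (components_of g F) \<le> ?n"
        using F by (simp add: relative_forests_def card_quotient_Id)
      moreover have "components_of g F \<noteq> {}" by (auto simp: components_of_def quotient_def)
      ultimately show "card (components_of g F) \<in> {1..?n}" by (simp add: Suc_le_eq card_gt_0_iff)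
    qed
  qed (simp_all add: finite_relative_forests fin)
  also have "\<dots> = (\<Sum>k=1..?n. monom ((-1) ^ (?n - k) * (\<Sum>F\<in>spanning_forests g k. forest_weight g F)) k)"
    by (rule sum.cong) (simp_all add: spanning_forests_eq[OF fin ends] monom_sum sum_distrib_left)
  finally show ?thesis .
qed

theorem theorem4p2:
  fixes g :: "('v::finite, 'e) weighted_multigraph" and n :: nat
  assumes "wf_weighted_multigraph g"
    and "n = CARD('v)"
  shows "(\<exists>c :: nat \<Rightarrow> real. laplacian_poly g = (\<Sum>k=1..n. monom ((-1) ^ (n - k) * c k) k)) \<and>
    (\<forall>c :: nat \<Rightarrow> real. laplacian_poly g = (\<Sum>k=1..n. monom ((-1) ^ (n - k) * c k) k) \<longrightarrow>
      (\<forall>k. 1 \<le> k \<and> k \<le> n \<longrightarrow> c k = (\<Sum>F\<in>spanning_forests g k. forest_weight g F)))"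
proof (intro conjI allI impI)
  note eq = laplacian_poly_eq_forest_sum[OF assms(1), folded assms(2)]
  show "\<exists>c :: nat \<Rightarrow> real. laplacian_poly g = (\<Sum>k=1..n. monom ((-1) ^ (n - k) * c k) k)"
    by (rule exI, rule eq)
  fix c :: "nat \<Rightarrow> real" and k
  assume c: "laplacian_poly g = (\<Sum>k=1..n. monom ((-1) ^ (n - k) * c k) k)" and k: "1 \<le> k \<and> k \<le> n"
  have coeff: "coeff (\<Sum>k=1..n. monom ((-1) ^ (n - k) * d k) k) k = (-1) ^ (n - k) * d k" for d :: "nat \<Rightarrow> real"
    using k by (simp add: coeff_sum)
  from arg_cong[OF trans[OF c[symmetric] eq], of "\<lambda>p. coeff p k"]
  show "c k = (\<Sum>F\<in>spanning_forests g k. forest_weight g F)"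
    unfolding coeff by simp
qed

end
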